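(* Let $(X,\tau)$ be an admissible pair, and let $\check{\mathcal B}_{\mathbf c,\mathbf s}=\check{\mathcal B}_{\mathbf c,\mathbf s}(X,\tau)$ and $\check{\mathcal B}_{\mathbf d,\mathbf t}=\check{\mathcal B}_{\mathbf d,\mathbf t}(X,\tau)$ be two right coideal subalgebras with simple generators of $\check{\mathcal U}_q(\mathfrak g')$. Let $t_1$ be a finite dimensional representation of $\check{\mathcal B}_{\mathbf c,\mathbf s}$ on $V$ and $t_2$ a finite dimensional representation of $\check{\mathcal B}_{\mathbf d,\mathbf t}$ on $W$. Let $Y\in\mathcal U_q(\mathfrak g')$ and let $\Phi\in\mathcal F_{t_1,t_2}(\check{\mathcal U}_q(\mathfrak g'))$ be a $(t_1,t_2)$-spherical function. Then for all $K_\lambda\in\mathcal A_{\mathrm{reg}}(Y)$, $$\mathrm{Res}(Y.\Phi)(K_\lambda)=\Pi_{t_1,t_2}(Y)(K_\lambda)\cdot\mathrm{Res}(\Phi).$$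
   Context: **Quantized enveloping algebra.** $I$ is a finite set, $A=(a_{ij})_{i,j\in I}$ is a generalized Cartan matrix, and $D=\mathrm{diag}(\epsilon_i:i\in I)$ has coprime positive integer entries such that $DA$ is symmetric. $Q=\bigoplus_{i\in I}\mathbb Z\alpha_i$ is the root lattice, with symmetric bilinear form $(\alpha_i,\alpha_j)=\epsilon_ia_{ij}$, extended to $\check Q=\frac12Q$. $Q^\vee=\bigoplus_{i\in I}\mathbb Zh_i$ is the coroot lattice, $\alpha_i(h_j)=a_{ji}$. Put $q_i=q^{\epsilon_i}$. $\check{\mathcal U}_q(\mathfrak g')$ is the unital associative $\mathbb C(q)$-algebra generated by $E_i,F_i$ ($i\in I$) and $K_h$ ($h\in\frac12Q^\vee$) with relations $K_0=1$, $K_hK_{h'}=K_{h+h'}$, $K_hE_i=q^{\alpha_i(h)}E_iK_h$, $K_hF_i=q^{-\alpha_i(h)}F_iK_h$, $[E_i,F_j]=\delta_{ij}\frac{K_i-K_i^{-1}}{q_i-q_i^{-1}}$ with $K_i=K_{\epsilon_ih_i}$, and the quantum Serre relations $\sum_{n=0}^{1-a_{ij}}(-1)^n\left[{1-a_{ij}\atop n}\right]_{q_i}Z_i^{1-a_{ij}-n}Z_jZ_i^n=0$ for $i\ne j$ and $Z=E$ or $Z=F$. For $\beta=\sum_in_i\alpha_i\in\check Q$ put $K_\beta=K_{\sum_in_i\epsilon_ih_i}$; so $K_{\alpha_i}=K_i$. $\mathcal U_q(\mathfrak g')\subset\check{\mathcal U}_q(\mathfrak g')$ is the subalgebra generated by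 $E_i,F_i,K_i^{\pm1}$ ($i\in I$). **Admissible pairs.** Let $X\subseteq I$ be such that $(a_{ij})_{i,j\in X}$ is of finite type, let $w_X$ be the longest element of the group $W_X$ generated by the reflections $r_i(\alpha)=\alpha-\alpha(h_i)\alpha_i$, $i\in X$, and let $\rho_X^\vee$ be the half sum of the positive coroots of the root system of $X$. Let $\tau$ be a permutation of $I$ with $a_{\tau(i)\tau(j)}=a_{ij}$ and $\tau(X)=X$. $(X,\tau)$ is admissible if $\tau^2=\mathrm{id}$; $-w_X(\alpha_j)=\alpha_{\tau(j)}$ for $j\in X$; and $\alpha_j(\rho_X^\vee)\in\mathbb Z$ whenever $j\in I\setminus X$ and $\tau(j)=j$. Put $\Theta(\alpha)=-w_X\tau(\alpha)$ with $\tau(\alpha_i)=\alpha_{\tau(i)}$. **Quantum involution.** $\theta_q=\mathrm{Ad}(s)\circ T_{w_X}\circ\psi\circ\tau\circ\omega$ is the algebra automorphism of $\mathcal U_q(\mathfrak g')$ built from: $\omega(E_i)=-F_i$, $\omega(F_i)=-E_i$, $\omega(K_i)=K_i^{-1}$; $\tau(Z_i)=Z_{\tau(i)}$ for $Z=E,F,K$; $\psi(E_i)=E_iK_i$, $\psi(F_i)=K_i^{-1}F_i$, $\psi(K_i)=K_i$; $T_{w_X}=T_{i_1}\cdots T_{i_r}$ for a reduced expression $w_X=r_{i_1}\cdots r_{i_r}$, with Lusztig's automorphisms $T_i(E_i)=-F_iK_i$, $T_i(F_i)=-K_i^{-1}E_i$, $T_i(K_\beta)=K_{r_i\beta}$ and,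 for $j\neq i$, $T_i(E_j)=\sum_{r+s=-a_{ij}}(-1)^rq_i^{-r}E_i^{(s)}E_jE_i^{(r)}$, $T_i(F_j)=\sum_{r+s=-a_{ij}}(-1)^rq_i^{r}F_i^{(r)}F_jF_i^{(s)}$, where $Z^{(n)}_i=Z_i^n/[n]_{q_i}!$; and $\mathrm{Ad}(s)$ multiplies elements of weight $\beta\in Q$ by $s(\beta)$, where $s:Q\to\mathbb C^\times$ is the homomorphism with (for a fixed total order on $I$) $s(\alpha_j)=1$ if $j\in X$ or $\tau(j)=j$, and $s(\alpha_j)=(\sqrt{-1})^{\alpha_j(2\rho_X^\vee)}$, resp. $(-\sqrt{-1})^{\alpha_j(2\rho_X^\vee)}$, if $j\notin X$ and $\tau(j)>j$, resp. $\tau(j)<j$. **Coideal subalgebras.** For $\mathbf c\in(\mathbb C(q)^\times)^{I\setminus X}$, $\mathbf s\in\mathbb C(q)^{I\setminus X}$, $\mathcal B_{\mathbf c,\mathbf s}(X,\tau)$ is the subalgebra of $\mathcal U_q(\mathfrak g')$ generated by $E_i,F_i,K_i^{\pm1}$ ($i\in X$), by $K_\beta$ ($\beta\in Q$, $\Theta(\beta)=\beta$) and by $B_i=F_i+c_i\theta_q(F_iK_i)K_i^{-1}+s_iK_i^{-1}$ ($i\in I\setminus X$). It has simple generators (and so does $\check{\mathcal B}_{\mathbf c,\mathbf s}$) if for every $i\in I\setminus X$ there is $v_i\in\mathbb C(q)^\times$ with $\theta_q(F_iK_i)=-v_iE_{\tau(i)}$. $\check{\mathcal B}_{\mathbf c,\mathbf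 s}$ is the subalgebra of $\check{\mathcal U}_q(\mathfrak g')$ generated by the $B_i$ ($i\in I\setminus X$), $E_i,F_i$ ($i\in X$), $K_\beta$ for $\beta\in\frac12\bigoplus_{i\in X}\mathbb Z\alpha_i$, and $K_\beta$ for $\beta\in\check Q$ with $\Theta(\beta)=\beta$. $\check{\mathcal B}_{\mathbf d,\mathbf t}$ is defined in the same way from parameters $\mathbf d,\mathbf t$. The quantum torus $\check{\mathcal A}$ is the subalgebra of $\check{\mathcal U}_q(\mathfrak g')$ generated by all $K_\beta$ with $\beta\in\check Q$, $\Theta(\beta)=-\beta$. **Spherical functions.** A linear map $\Phi:\check{\mathcal U}_q(\mathfrak g')\to\mathrm{Hom}(W,V)$ is a $(t_1,t_2)$-spherical function if $\Phi(BZB')=t_1(B)\Phi(Z)t_2(B')$ for all $B\in\check{\mathcal B}_{\mathbf c,\mathbf s}$, $B'\in\check{\mathcal B}_{\mathbf d,\mathbf t}$, $Z\in\check{\mathcal U}_q(\mathfrak g')$; $\mathcal F_{t_1,t_2}(\check{\mathcal U}_q(\mathfrak g'))$ is the space of these. $Y.\Phi$ is the linear map $(Y.\Phi)(Z)=\Phi(ZY)$, and $\mathrm{Res}$ denotes restriction of a linear map to $\check{\mathcal A}$. **Regular points.** For $U=(u_1,\dots,u_k)\in(I\setminus X)^k$ put $F_U=F_{u_1}\cdots F_{u_k}$, and put $\mu_i=\frac12(\alpha_i-\Theta(\alpha_i))$. $\mathcal A_{\mathrm{reg}}(1)$ consists of all $K_\lambda$ with $\lambda\in\check Q$, $\Theta(\lambda)=-\lambda$.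 For $k>0$, $\mathcal A_{\mathrm{reg}}(F_U)$ is the set of all $K_\lambda$ with $\lambda\in\check Q$, $\Theta(\lambda)=-\lambda$, such that $$\frac{c_{v_1}\cdots c_{v_{k-\ell}}}{d_{v_1}\cdots d_{v_{k-\ell}}}\neq q^{\,\sum_{i=1}^{k-\ell}(\lambda+\mu,\alpha_{v_i}+\alpha_{\tau(v_i)})-\sum_{1\le i,j\le k-\ell,\,i\ne j}(\alpha_{v_i},\alpha_{v_j})}$$ for all $0\le\ell<k$, all subsequences $(v_1,\dots,v_{k-\ell})$ of $U$, and all $\mu=\sum_jN_j\mu_{u_j}$ with $N_j\in\{-1,0,1\}$. For $Y\in\mathcal U_q(\mathfrak g')$ and $\lambda\in\check Q$ with $\Theta(\lambda)=-\lambda$ one can write (quantum Iwasawa decomposition) $K_\lambda Y=\sum_jC_jK_{\lambda_j}F_{V_j}$, a finite sum with $C_j\in\check{\mathcal B}_{\mathbf c,\mathbf s}$, $\lambda_j\in\check Q$, $\Theta(\lambda_j)=-\lambda_j$, $V_j\in\bigcup_{n\ge0}(I\setminus X)^n$; fix one such expression for each $(\lambda,Y)$. $\mathcal A_{\mathrm{reg}}(Y)$ is the set of $K_\lambda$ such that $K_{\lambda_j}\in\mathcal A_{\mathrm{reg}}(F_{V_j})$ for all $j$. **Radial part.** For $K_\lambda\in\mathcal A_{\mathrm{reg}}(Y)$ each $K_{\lambda_j}F_{V_j}$, hence $K_\lambda Y$, lies in the span of products $\check{\mathcal B}_{\mathbf c,\mathbf s}\check{\mathcal A}\check{\mathcal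 B}_{\mathbf d,\mathbf t}$. $\Pi(Y):\mathcal A_{\mathrm{reg}}(Y)\to\check{\mathcal B}_{\mathbf c,\mathbf s}\otimes\check{\mathcal A}\otimes\check{\mathcal B}_{\mathbf d,\mathbf t}$ is a (fixed) map assigning to $K_\lambda$ an element $\sum_iB_i\otimes K_{\lambda_i'}\otimes B_i'$ with $\sum_iB_iK_{\lambda_i'}B_i'=K_\lambda Y$. Put $\Pi_{t_1,t_2}(Y)=(t_1\otimes1\otimes t_2)\circ\Pi(Y)$, with values in $\mathrm{End}(V)\otimes\check{\mathcal A}\otimes\mathrm{End}(W)$. The pairing $\cdot$ is the bilinear map determined by $(T_1\otimes K_\lambda\otimes T_2)\cdot\mathrm{Res}(\Phi)=T_1\Phi(K_\lambda)T_2$.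
   Formalization: The relations for K_h with h in half the coroot lattice need half-integral powers of q, which are not in C(q); the algebras and the spaces V, W are therefore taken over C(q^{1/2}), while the parameters c, s, d, t and the v_i stay in C(q). *)

theory Defs
  imports
    "HOL-Computational_Algebra.Computational_Algebra"
    "HOL-Library.Poly_Mapping"
    "HOL-Library.Function_Algebras"
    "HOL-Library.Sublist"
    "HOL-Library.FuncSet"
begin

section \<open>Ground field\<close>

text \<open>
  The relation \<open>K_h E_i = q^(\<alpha>_i(h)) E_i K_h\<close> with \<open>h\<close> in half the coroot lattice involves
  half-integral powers of \<open>q\<close>. The ground field is therefore \<open>\<complex>(q^(1/2))\<close>, realised as the
  rational function field whose indeterminate \<open>qh\<close> is \<open>q^(1/2)\<close>; the field \<open>\<complex>(q)\<close>, in which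
  the parameters of the coideal subalgebras live, is its subfield \<open>Cq\<close>.
\<close>

type_synonym qf = "complex poly fract"

lifting_forget fract.lifting

definition qh :: qf where
  "qh = Fract [:0, 1:] 1"

definition qpow :: "rat \<Rightarrow> qf" where \<comment> \<open>\<open>q^r\<close>, used for \<open>2r \<in> \<int>\<close> only\<close>
  "qpow r = qh powi \<lfloor>2 * r\<rfloor>"

definition const_qf :: "complex \<Rightarrow> qf" where
  "const_qf z = Fract [:z:] 1"

definition Cq :: "qf set" where
  "Cq = {Fract (a \<circ>\<^sub>p [:0, 0, 1:]) (b \<circ>\<^sub>p [:0, 0, 1:]) | a b. b \<noteq> 0}"

definition qint :: "qf \<Rightarrow> nat \<Rightarrow> qf" where
  "qint v n = (v ^ n - inverse v ^ n) / (v - inverse v)"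

definition qfact :: "qf \<Rightarrow> nat \<Rightarrow> qf" where
  "qfact v n = (\<Prod>k = 1..n. qint v k)"

definition qbinom :: "qf \<Rightarrow> nat \<Rightarrow> nat \<Rightarrow> qf" where \<comment> \<open>for \<open>k \<le> n\<close>\<close>
  "qbinom v n k = qfact v n / (qfact v k * qfact v (n - k))"


section \<open>Vector spaces and algebras over the ground field\<close>

class qspace = ab_group_add +
  fixes scaleq :: "qf \<Rightarrow> 'a \<Rightarrow> 'a" (infixr \<open>*\<^sub>q\<close> 75)
  assumes scaleq_add_right: "a *\<^sub>q (x + y) = a *\<^sub>q x + a *\<^sub>q y"
    and scaleq_add_left: "(a + b) *\<^sub>q x = a *\<^sub>q x + b *\<^sub>q x"
    and scaleq_scaleq: "a *\<^sub>q (b *\<^sub>q x) = (a * b) *\<^sub>q x"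
    and scaleq_one: "1 *\<^sub>q x = x"

global_interpretation qspace: vector_space "scaleq :: qf \<Rightarrow> 'a \<Rightarrow> 'a::qspace"
  by standard (simp_all add: scaleq_add_right scaleq_add_left scaleq_scaleq scaleq_one)

abbreviation qlinear :: "('a::qspace \<Rightarrow> 'b::qspace) \<Rightarrow> bool" where
  "qlinear \<equiv> Vector_Spaces.linear scaleq scaleq"

definition qfinite_dim :: "'a::qspace set \<Rightarrow> bool" where
  "qfinite_dim S \<longleftrightarrow> (\<exists>B. finite B \<and> qspace.span B = S)"

instantiation "fun" :: (type, qspace) qspace
begin
definition scaleq_fun :: "qf \<Rightarrow> ('a \<Rightarrow> 'b) \<Rightarrow> 'a \<Rightarrow> 'b" where
  "scaleq_fun a f = (\<lambda>x. a *\<^sub>q f x)"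
instance
  by standard (auto simp: scaleq_fun_def scaleq_add_right scaleq_add_left scaleq_scaleq scaleq_one)
end

class qalgebra = ring + monoid_mult + qspace +
  assumes scaleq_mult_left: "(a *\<^sub>q x) * y = a *\<^sub>q (x * y)"
    and scaleq_mult_right: "x * (a *\<^sub>q y) = a *\<^sub>q (x * y)"

inductive_set subalg :: "'a::qalgebra set \<Rightarrow> 'a set" for S where
  gen: "x \<in> S \<Longrightarrow> x \<in> subalg S"
| one: "1 \<in> subalg S"
| add: "x \<in> subalg S \<Longrightarrow> y \<in> subalg S \<Longrightarrow> x + y \<in> subalg S"
| mult: "x \<in> subalg S \<Longrightarrow> y \<in> subalg S \<Longrightarrow> x * y \<in> subalg S"
| scale: "x \<in> subalg S \<Longrightarrow> a *\<^sub>q x \<in> subalg S"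

definition alg_aut_on :: "'a::qalgebra set \<Rightarrow> ('a \<Rightarrow> 'a) \<Rightarrow> bool" where
  "alg_aut_on S f \<longleftrightarrow> bij_betw f S S \<and> f 1 = 1 \<and>
     (\<forall>x\<in>S. \<forall>y\<in>S. f (x + y) = f x + f y \<and> f (x * y) = f x * f y) \<and>
     (\<forall>a. \<forall>x\<in>S. f (a *\<^sub>q x) = a *\<^sub>q f x)"

definition representation :: "'a::qalgebra set \<Rightarrow> ('a \<Rightarrow> 'v \<Rightarrow> 'v::qspace) \<Rightarrow> bool" where
  "representation S t \<longleftrightarrow> (\<forall>x\<in>S. qlinear (t x)) \<and> t 1 = id \<and>
     (\<forall>x\<in>S. \<forall>y\<in>S. t (x + y) = t x + t y \<and> t (x * y) = t x \<circ> t y) \<and>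
     (\<forall>a. \<forall>x\<in>S. t (a *\<^sub>q x) = a *\<^sub>q t x)"


section \<open>Threefold tensor products\<close>

text \<open>
  \<open>U \<otimes> V \<otimes> W\<close> is the space of formal linear combinations of triples modulo the subspace generated
  by the multilinearity relations. For subspaces \<open>A\<close>, \<open>B\<close>, \<open>C\<close> the tensor product
  \<open>A \<otimes> B \<otimes> C\<close> is identified with the span of the pure tensors \<open>a \<otimes> b \<otimes> c\<close> in \<open>U \<otimes> V \<otimes> W\<close>.
\<close>

inductive_set tensor_null :: "(('a::qspace \<times> 'b::qspace \<times> 'c::qspace) \<Rightarrow>\<^sub>0 qf) set" where
  zero: "0 \<in> tensor_null"
| add: "x \<in> tensor_null \<Longrightarrow> y \<in> tensor_null \<Longrightarrow> x + y \<in> tensor_null"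
| minus: "x \<in> tensor_null \<Longrightarrow> - x \<in> tensor_null"
| add1: "Poly_Mapping.single (u + u', v, w) k
         - (Poly_Mapping.single (u, v, w) k + Poly_Mapping.single (u', v, w) k) \<in> tensor_null"
| add2: "Poly_Mapping.single (u, v + v', w) k
         - (Poly_Mapping.single (u, v, w) k + Poly_Mapping.single (u, v', w) k) \<in> tensor_null"
| add3: "Poly_Mapping.single (u, v, w + w') k
         - (Poly_Mapping.single (u, v, w) k + Poly_Mapping.single (u, v, w') k) \<in> tensor_null"
| scale1: "Poly_Mapping.single (a *\<^sub>q u, v, w) k - Poly_Mapping.single (u, v, w) (a * k) \<in> tensor_null"
| scale2: "Poly_Mapping.single (u, a *\<^sub>q v, w) k - Poly_Mapping.single (u, v, w) (a * k) \<in> tensor_null"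
| scale3: "Poly_Mapping.single (u, v, a *\<^sub>q w) k - Poly_Mapping.single (u, v, w) (a * k) \<in> tensor_null"

definition tensor_eq ::
  "(('a::qspace \<times> 'b::qspace \<times> 'c::qspace) \<Rightarrow>\<^sub>0 qf) \<Rightarrow> (('a \<times> 'b \<times> 'c) \<Rightarrow>\<^sub>0 qf) \<Rightarrow> bool" where
  "tensor_eq x y \<longleftrightarrow> x - y \<in> tensor_null"

lemma tensor_null_diff:
  "x \<in> tensor_null \<Longrightarrow> y \<in> tensor_null \<Longrightarrow> x - y \<in> tensor_null"
  using tensor_null.add[OF _ tensor_null.minus, of x y] by simp

quotient_type (overloaded) ('a, 'b, 'c) tensor3 =
  "('a::qspace \<times> 'b::qspace \<times> 'c::qspace) \<Rightarrow>\<^sub>0 qf" / tensor_eq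
proof (rule equivpI)
  show "reflp tensor_eq"
    by (auto simp: reflp_def tensor_eq_def intro: tensor_null.zero)
  show "symp tensor_eq"
    unfolding symp_def tensor_eq_def
  proof (intro allI impI)
    fix x y assume "x - y \<in> tensor_null"
    from tensor_null.minus[OF this] show "y - x \<in> tensor_null" by simp
  qed
  show "transp tensor_eq"
    unfolding transp_def tensor_eq_def
  proof (intro allI impI)
    fix x y z assume "x - y \<in> tensor_null" "y - z \<in> tensor_null"
    from tensor_null.add[OF this] show "x - z \<in> tensor_null" by simp
  qed
qed

lemma map_scale_single:
  "Poly_Mapping.map ((*) (a::qf)) (Poly_Mapping.single x k) = Poly_Mapping.single x (a * k)"
  by (rule poly_mapping_eqI) (auto simp: Poly_Mapping.map.rep_eq lookup_single when_def)

lemma map_scale_add: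
  "Poly_Mapping.map ((*) (a::qf)) (x + y) = Poly_Mapping.map ((*) a) x + Poly_Mapping.map ((*) a) y"
  by (rule poly_mapping_eqI)
    (auto simp: Poly_Mapping.map.rep_eq lookup_add when_def distrib_left[symmetric])

lemma map_scale_minus:
  "Poly_Mapping.map ((*) (a::qf)) (- x) = - Poly_Mapping.map ((*) a) x"
  by (rule poly_mapping_eqI) (auto simp: Poly_Mapping.map.rep_eq when_def)

lemma map_scale_diff:
  "Poly_Mapping.map ((*) (a::qf)) (x - y) = Poly_Mapping.map ((*) a) x - Poly_Mapping.map ((*) a) y"
  by (rule poly_mapping_eqI) (auto simp: Poly_Mapping.map.rep_eq lookup_minus when_def algebra_simps)

lemma tensor_null_scale: "x \<in> tensor_null \<Longrightarrow> Poly_Mapping.map ((*) a) x \<in> tensor_null"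
proof (induction rule: tensor_null.induct)
  case zero
  show ?case
    using map_scale_diff[of a 0 "0 :: ('a \<times> 'b \<times> 'c) \<Rightarrow>\<^sub>0 qf"] by (simp add: tensor_null.zero)
next
  case (scale1 b u v w k)
  then show ?case
    using tensor_null.scale1[of b u v w "a * k"] by (simp add: map_scale_diff map_scale_single mult.left_commute)
next
  case (scale2 u b v w k)
  then show ?case
    using tensor_null.scale2[of u b v w "a * k"] by (simp add: map_scale_diff map_scale_single mult.left_commute)
next
  case (scale3 u v b w k)
  then show ?case
    using tensor_null.scale3[of u v b w "a * k"] by (simp add: map_scale_diff map_scale_single mult.left_commute)
qed (simp_all add: map_scale_add map_scale_minus map_scale_diff map_scale_single tensor_null.intros)

context
  fixes a :: qf
begin
lift_definition tensor3_scale ::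
  "('a::qspace, 'b::qspace, 'c::qspace) tensor3 \<Rightarrow> ('a, 'b, 'c) tensor3" is "Poly_Mapping.map ((*) a)"
  unfolding tensor_eq_def by (subst map_scale_diff[symmetric]) (rule tensor_null_scale)
end

instantiation tensor3 :: (qspace, qspace, qspace) qspace
begin

lift_definition zero_tensor3 :: "('a, 'b, 'c) tensor3" is 0 .

lift_definition plus_tensor3 ::
  "('a, 'b, 'c) tensor3 \<Rightarrow> ('a, 'b, 'c) tensor3 \<Rightarrow> ('a, 'b, 'c) tensor3" is "(+)"
  unfolding tensor_eq_def by (subst add_diff_add) (rule tensor_null.add)

lift_definition uminus_tensor3 :: "('a, 'b, 'c) tensor3 \<Rightarrow> ('a, 'b, 'c) tensor3" is uminus
  unfolding tensor_eq_def by (subst minus_diff_minus) (rule tensor_null.minus)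

lift_definition minus_tensor3 ::
  "('a, 'b, 'c) tensor3 \<Rightarrow> ('a, 'b, 'c) tensor3 \<Rightarrow> ('a, 'b, 'c) tensor3" is "(-)"
proof -
  fix x x' y y' :: "('a \<times> 'b \<times> 'c) \<Rightarrow>\<^sub>0 qf"
  assume "tensor_eq x x'" "tensor_eq y y'"
  then have "(x - x') - (y - y') \<in> tensor_null"
    unfolding tensor_eq_def by (rule tensor_null_diff)
  moreover have "(x - x') - (y - y') = x - y - (x' - y')" by (simp add: algebra_simps)
  ultimately show "tensor_eq (x - y) (x' - y')"
    unfolding tensor_eq_def by (simp only:)
qed

definition scaleq_tensor3 :: "qf \<Rightarrow> ('a, 'b, 'c) tensor3 \<Rightarrow> ('a, 'b, 'c) tensor3" where
  "scaleq_tensor3 = tensor3_scale"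

lemma scaleq_tensor3_transfer [transfer_rule]:
  "rel_fun (=) (rel_fun cr_tensor3 cr_tensor3) (\<lambda>a. Poly_Mapping.map ((*) a))
    (scaleq :: qf \<Rightarrow> ('a, 'b, 'c) tensor3 \<Rightarrow> ('a, 'b, 'c) tensor3)"
  unfolding scaleq_tensor3_def
  by (intro rel_funI, hypsubst, erule rel_funD[OF tensor3_scale.transfer])

instance
proof
  fix a b :: qf and x y z :: "('a, 'b, 'c) tensor3"
  show "x + y + z = x + (y + z)"
    by transfer (simp add: add.assoc tensor_eq_def tensor_null.zero)
  show "x + y = y + x"
    by transfer (simp add: add.commute tensor_eq_def tensor_null.zero)
  show "0 + x = x"
    by transfer (simp add: tensor_eq_def tensor_null.zero)
  show "- x + x = 0"
    by transfer (simp add: tensor_eq_def tensor_null.zero)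
  show "x - y = x + - y"
    by transfer (simp add: tensor_eq_def tensor_null.zero)
  show "a *\<^sub>q (x + y) = a *\<^sub>q x + a *\<^sub>q y"
    by (transfer fixing: a b) (simp add: tensor_eq_def tensor_null.zero map_scale_add)
  show "(a + b) *\<^sub>q x = a *\<^sub>q x + b *\<^sub>q x"
  proof (transfer fixing: a b)
    fix x :: "('a \<times> 'b \<times> 'c) \<Rightarrow>\<^sub>0 qf"
    have "Poly_Mapping.map ((*) (a + b)) x = Poly_Mapping.map ((*) a) x + Poly_Mapping.map ((*) b) x"
      by (rule poly_mapping_eqI) (auto simp: Poly_Mapping.map.rep_eq lookup_add when_def algebra_simps)
    then show "tensor_eq (Poly_Mapping.map ((*) (a + b)) x)
        (Poly_Mapping.map ((*) a) x + Poly_Mapping.map ((*) b) x)"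
      by (simp add: tensor_eq_def tensor_null.zero)
  qed
  show "a *\<^sub>q (b *\<^sub>q x) = (a * b) *\<^sub>q x"
  proof (transfer fixing: a b)
    fix x :: "('a \<times> 'b \<times> 'c) \<Rightarrow>\<^sub>0 qf"
    have "Poly_Mapping.map ((*) a) (Poly_Mapping.map ((*) b) x) = Poly_Mapping.map ((*) (a * b)) x"
      by (rule poly_mapping_eqI) (auto simp: Poly_Mapping.map.rep_eq when_def algebra_simps)
    then show "tensor_eq (Poly_Mapping.map ((*) a) (Poly_Mapping.map ((*) b) x))
        (Poly_Mapping.map ((*) (a * b)) x)"
      by (simp add: tensor_eq_def tensor_null.zero)
  qed
  show "1 *\<^sub>q x = x"
  proof (transfer fixing: a b)
    fix x :: "('a \<times> 'b \<times> 'c) \<Rightarrow>\<^sub>0 qf"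
    have "Poly_Mapping.map ((*) 1) x = x"
      by (rule poly_mapping_eqI) (auto simp: Poly_Mapping.map.rep_eq when_def)
    then show "tensor_eq (Poly_Mapping.map ((*) 1) x) x"
      by (simp add: tensor_eq_def tensor_null.zero)
  qed
qed

end

lift_definition pure3 :: "'a::qspace \<Rightarrow> 'b::qspace \<Rightarrow> 'c::qspace \<Rightarrow> ('a, 'b, 'c) tensor3"
  is "\<lambda>u v w. Poly_Mapping.single (u, v, w) 1" .

text \<open>
  The linear map on \<open>A \<otimes> B \<otimes> C\<close> induced by a map \<open>\<beta>\<close> that is trilinear on the subspaces \<open>A\<close>,
  \<open>B\<close>, \<open>C\<close>. Its values outside \<open>A \<otimes> B \<otimes> C\<close> are irrelevant; on \<open>A \<otimes> B \<otimes> C\<close> the choice is unique.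
\<close>

definition induced3 ::
  "'a::qspace set \<Rightarrow> 'b::qspace set \<Rightarrow> 'c::qspace set \<Rightarrow> ('a \<Rightarrow> 'b \<Rightarrow> 'c \<Rightarrow> 'd::qspace)
   \<Rightarrow> ('a, 'b, 'c) tensor3 \<Rightarrow> 'd" where
  "induced3 A B C \<beta> = (SOME f. qlinear f \<and> (\<forall>a\<in>A. \<forall>b\<in>B. \<forall>c\<in>C. f (pure3 a b c) = \<beta> a b c))"


section \<open>Root data\<close>

text \<open>
  The generalized Cartan matrix, the symmetrizer and the total order on the index set \<open>I\<close> are
  carried by the index type \<open>'i\<close>. Elements of \<open>\<rat> \<otimes> Q\<close> and \<open>\<rat> \<otimes> Q\<^sup>\<or>\<close> are given by their
  coordinates with respect to the simple roots \<open>\<alpha>_i\<close> resp. the simple coroots \<open>h_i\<close>.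
\<close>

class cartan_datum = finite + linorder +
  fixes cartan :: "'a \<Rightarrow> 'a \<Rightarrow> int"
    and eps :: "'a \<Rightarrow> nat"
  assumes cartan_diag: "cartan i i = 2"
    and cartan_off_diag: "i \<noteq> j \<Longrightarrow> cartan i j \<le> 0"
    and cartan_zero: "cartan i j = 0 \<Longrightarrow> cartan j i = 0"
    and eps_pos: "eps i > 0"
    and eps_coprime: "Gcd (eps ` UNIV) = 1"
    and eps_cartan_sym: "int (eps i) * cartan i j = int (eps j) * cartan j i"

definition simple :: "'i \<Rightarrow> 'i \<Rightarrow> rat" where \<comment> \<open>both \<open>\<alpha>_i\<close> and \<open>h_i\<close>\<close>
  "simple i = (\<lambda>j. if j = i then 1 else 0)"

definition Qlat :: "('i \<Rightarrow> rat) set" where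
  "Qlat = {\<beta>. \<forall>i. \<beta> i \<in> \<int>}"

definition Qcheck :: "('i \<Rightarrow> rat) set" where
  "Qcheck = {\<beta>. \<forall>i. 2 * \<beta> i \<in> \<int>}"

definition ev :: "('i::cartan_datum \<Rightarrow> rat) \<Rightarrow> ('i \<Rightarrow> rat) \<Rightarrow> rat" where
  \<comment> \<open>the value \<open>\<beta>(h)\<close>, with \<open>\<alpha>_i(h_j) = a_ji\<close>\<close>
  "ev \<beta> h = (\<Sum>i\<in>UNIV. \<Sum>j\<in>UNIV. \<beta> i * h j * of_int (cartan j i))"

definition form :: "('i::cartan_datum \<Rightarrow> rat) \<Rightarrow> ('i \<Rightarrow> rat) \<Rightarrow> rat" where
  "form \<beta> \<gamma> = (\<Sum>i\<in>UNIV. \<Sum>j\<in>UNIV. \<beta> i * \<gamma> j * of_nat (eps i) * of_int (cartan i j))"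

definition refl :: "'i::cartan_datum \<Rightarrow> ('i \<Rightarrow> rat) \<Rightarrow> 'i \<Rightarrow> rat" where
  "refl i \<beta> = (\<lambda>j. \<beta> j - ev \<beta> (simple i) * simple i j)"

definition corefl :: "'i::cartan_datum \<Rightarrow> ('i \<Rightarrow> rat) \<Rightarrow> 'i \<Rightarrow> rat" where
  "corefl i h = (\<lambda>j. h j - ev (simple i) h * simple i j)"

definition refl_word :: "'i::cartan_datum list \<Rightarrow> ('i \<Rightarrow> rat) \<Rightarrow> 'i \<Rightarrow> rat" where
  "refl_word js = foldr (\<lambda>i f. refl i \<circ> f) js id"

definition corefl_word :: "'i::cartan_datum list \<Rightarrow> ('i \<Rightarrow> rat) \<Rightarrow> 'i \<Rightarrow> rat" where
  "corefl_word js = foldr (\<lambda>i f. corefl i \<circ> f) js id"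

definition finite_type :: "'i::cartan_datum set \<Rightarrow> bool" where
  \<comment> \<open>the symmetrized submatrix \<open>(\<epsilon>_i a_ij)\<close>, \<open>i, j \<in> X\<close>, is positive definite\<close>
  "finite_type X \<longleftrightarrow>
     (\<forall>x :: 'i \<Rightarrow> real. (\<exists>i\<in>X. x i \<noteq> 0) \<longrightarrow>
        (\<Sum>i\<in>X. \<Sum>j\<in>X. real (eps i) * of_int (cartan i j) * x i * x j) > 0)"

definition weyl :: "'i::cartan_datum set \<Rightarrow> (('i \<Rightarrow> rat) \<Rightarrow> 'i \<Rightarrow> rat) set" where
  "weyl X = refl_word ` lists X"

definition weyl_length :: "'i::cartan_datum set \<Rightarrow> (('i \<Rightarrow> rat) \<Rightarrow> 'i \<Rightarrow> rat) \<Rightarrow> nat" where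
  "weyl_length X w = (LEAST n. \<exists>js\<in>lists X. refl_word js = w \<and> length js = n)"

definition longest :: "'i::cartan_datum set \<Rightarrow> ('i \<Rightarrow> rat) \<Rightarrow> 'i \<Rightarrow> rat" where
  "longest X = (THE w. w \<in> weyl X \<and> (\<forall>w'\<in>weyl X. weyl_length X w' \<le> weyl_length X w))"

definition longest_word :: "'i::cartan_datum set \<Rightarrow> 'i list" where
  "longest_word X = (SOME js. js \<in> lists X \<and> refl_word js = longest X \<and>
     length js = weyl_length X (longest X))"

definition pos_coroots :: "'i::cartan_datum set \<Rightarrow> ('i \<Rightarrow> rat) set" where
  "pos_coroots X = {h. (\<exists>js\<in>lists X. \<exists>j\<in>X. h = corefl_word js (simple j)) \<and> (\<forall>i. h i \<ge> 0)}"

definition rho_check :: "'i::cartan_datum set \<Rightarrow> 'i \<Rightarrow> rat" where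
  "rho_check X = (\<lambda>i. (\<Sum>h\<in>pos_coroots X. h i) / 2)"


section \<open>Admissible pairs\<close>

definition tau_root :: "('i \<Rightarrow> 'i) \<Rightarrow> ('i \<Rightarrow> rat) \<Rightarrow> 'i \<Rightarrow> rat" where
  "tau_root \<tau> \<beta> = \<beta> \<circ> inv \<tau>"

definition admissible :: "'i::cartan_datum set \<Rightarrow> ('i \<Rightarrow> 'i) \<Rightarrow> bool" where
  "admissible X \<tau> \<longleftrightarrow>
     finite_type X \<and>
     bij \<tau> \<and> (\<forall>i j. cartan (\<tau> i) (\<tau> j) = cartan i j) \<and> \<tau> ` X = X \<and>
     \<tau> \<circ> \<tau> = id \<and>
     (\<forall>j\<in>X. - longest X (simple j) = simple (\<tau> j)) \<and>
     (\<forall>j. j \<notin> X \<and> \<tau> j = j \<longrightarrow> ev (simple j) (rho_check X) \<in> \<int>)"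

definition Theta :: "'i::cartan_datum set \<Rightarrow> ('i \<Rightarrow> 'i) \<Rightarrow> ('i \<Rightarrow> rat) \<Rightarrow> 'i \<Rightarrow> rat" where
  "Theta X \<tau> \<beta> = - longest X (tau_root \<tau> \<beta>)"

definition Qplus :: "'i::cartan_datum set \<Rightarrow> ('i \<Rightarrow> 'i) \<Rightarrow> ('i \<Rightarrow> rat) set" where
  "Qplus X \<tau> = {\<beta> \<in> Qcheck. Theta X \<tau> \<beta> = \<beta>}"

definition Qminus :: "'i::cartan_datum set \<Rightarrow> ('i \<Rightarrow> 'i) \<Rightarrow> ('i \<Rightarrow> rat) set" where
  "Qminus X \<tau> = {\<beta> \<in> Qcheck. Theta X \<tau> \<beta> = - \<beta>}"


section \<open>The quantized enveloping algebra\<close>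

text \<open>Words form the free monoid, so that \<open>'g list \<Rightarrow>\<^sub>0 qf\<close> is the free associative algebra on \<open>'g\<close>.\<close>

instantiation list :: (type) monoid_add
begin
definition zero_list :: "'a list" where "zero_list = []"
definition plus_list :: "'a list \<Rightarrow> 'a list \<Rightarrow> 'a list" where "plus_list = append"
instance by standard (simp_all add: zero_list_def plus_list_def)
end

text \<open>\<open>GenK m\<close> stands for the generator \<open>K_h\<close> with \<open>h = \<onehalf> \<Sum>\<^sub>i m_i h_i\<close>.\<close>

datatype 'i gen = GenE 'i | GenF 'i | GenK "'i \<Rightarrow> int"

type_synonym 'i free_alg = "'i gen list \<Rightarrow>\<^sub>0 qf"

abbreviation fgen :: "'i gen \<Rightarrow> 'i free_alg" where
  "fgen g \<equiv> Poly_Mapping.single [g] 1"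

abbreviation fconst :: "qf \<Rightarrow> 'i free_alg" where
  "fconst a \<equiv> Poly_Mapping.single [] a"

abbreviation fK :: "'i \<Rightarrow> int \<Rightarrow> 'i free_alg" where \<comment> \<open>\<open>K_{n h_i}\<close>\<close>
  "fK i n \<equiv> fgen (GenK (\<lambda>j. if j = i then 2 * n else 0))"

definition qi :: "'i::cartan_datum \<Rightarrow> qf" where
  "qi i = qpow (of_nat (eps i))"

definition serre :: "('i \<Rightarrow> 'i gen) \<Rightarrow> 'i::cartan_datum \<Rightarrow> 'i \<Rightarrow> 'i free_alg" where
  "serre Z i j = (let m = nat (1 - cartan i j) in
     \<Sum>n = 0..m. fconst ((- 1) ^ n * qbinom (qi i) m n) *
       fgen (Z i) ^ (m - n) * fgen (Z j) * fgen (Z i) ^ n)"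

inductive_set uq_rels :: "'i::cartan_datum free_alg set" where
  K_zero: "fgen (GenK 0) - 1 \<in> uq_rels"
| K_add: "fgen (GenK m) * fgen (GenK n) - fgen (GenK (m + n)) \<in> uq_rels"
| K_E: "fgen (GenK m) * fgen (GenE i)
        - fconst (qpow ((\<Sum>j\<in>UNIV. of_int (m j * cartan j i)) / 2))
          * fgen (GenE i) * fgen (GenK m) \<in> uq_rels"
| K_F: "fgen (GenK m) * fgen (GenF i)
        - fconst (qpow (- (\<Sum>j\<in>UNIV. of_int (m j * cartan j i)) / 2))
          * fgen (GenF i) * fgen (GenK m) \<in> uq_rels"
| E_F_eq: "fgen (GenE i) * fgen (GenF i) - fgen (GenF i) * fgen (GenE i)
        - fconst (1 / (qi i - inverse (qi i)))
          * (fK i (int (eps i)) - fK i (- int (eps i))) \<in> uq_rels"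
| E_F_neq: "i \<noteq> j \<Longrightarrow>
        fgen (GenE i) * fgen (GenF j) - fgen (GenF j) * fgen (GenE i) \<in> uq_rels"
| serre_E: "i \<noteq> j \<Longrightarrow> serre GenE i j \<in> uq_rels"
| serre_F: "i \<noteq> j \<Longrightarrow> serre GenF i j \<in> uq_rels"

inductive_set uq_ideal :: "'i::cartan_datum free_alg set" where
  rel: "x \<in> uq_rels \<Longrightarrow> x \<in> uq_ideal"
| zero: "0 \<in> uq_ideal"
| add: "x \<in> uq_ideal \<Longrightarrow> y \<in> uq_ideal \<Longrightarrow> x + y \<in> uq_ideal"
| left: "x \<in> uq_ideal \<Longrightarrow> y * x \<in> uq_ideal"
| right: "x \<in> uq_ideal \<Longrightarrow> x * y \<in> uq_ideal"

lemma uq_ideal_minus: "x \<in> uq_ideal \<Longrightarrow> - x \<in> uq_ideal"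
  using uq_ideal.left[of x "- 1"] by simp

lemma uq_ideal_diff: "x \<in> uq_ideal \<Longrightarrow> y \<in> uq_ideal \<Longrightarrow> x - y \<in> uq_ideal"
  using uq_ideal.add[OF _ uq_ideal_minus, of x y] by simp

definition uq_eq :: "'i::cartan_datum free_alg \<Rightarrow> 'i free_alg \<Rightarrow> bool" where
  "uq_eq x y \<longleftrightarrow> x - y \<in> uq_ideal"

lemma uq_eq_refl: "uq_eq x x"
  by (simp add: uq_eq_def uq_ideal.zero)

quotient_type (overloaded) 'i uq = "'i::cartan_datum free_alg" / uq_eq
proof (rule equivpI)
  show "reflp uq_eq"
    by (auto simp: reflp_def uq_eq_refl)
  show "symp uq_eq"
    unfolding symp_def uq_eq_def
  proof (intro allI impI)
    fix x y assume "x - y \<in> uq_ideal"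
    from uq_ideal_minus[OF this] show "y - x \<in> uq_ideal" by simp
  qed
  show "transp uq_eq"
    unfolding transp_def uq_eq_def
  proof (intro allI impI)
    fix x y z assume "x - y \<in> uq_ideal" "y - z \<in> uq_ideal"
    from uq_ideal.add[OF this] show "x - z \<in> uq_ideal" by simp
  qed
qed

lemma poly_mapping_add_induct [case_names zero add]:
  fixes x :: "'a \<Rightarrow>\<^sub>0 'b::comm_monoid_add"
  assumes "P 0" and "\<And>k v x. P x \<Longrightarrow> P (Poly_Mapping.single k v + x)"
  shows "P x"
proof (induction x rule: update_induct)
  case const
  show ?case by (rule assms(1))
next
  case (update f k v)
  have "Poly_Mapping.update k v f = Poly_Mapping.single k v + f"
    using update.hyps
    by (intro poly_mapping_eqI) (auto simp: lookup_update lookup_add lookup_single in_keys_iff)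
  then show ?case using assms(2) update by simp
qed

lemma fconst_central: "fconst a * x = x * fconst a"
proof (induction x rule: poly_mapping_add_induct)
  case zero
  show ?case by simp
next
  case (add k v x)
  then show ?case
    by (simp add: mult_single plus_list_def mult.commute[of a v] distrib_left distrib_right)
qed

context
  fixes a :: qf
begin
lift_definition uq_scale :: "'i::cartan_datum uq \<Rightarrow> 'i uq" is "\<lambda>x. fconst a * x"
  unfolding uq_eq_def by (subst right_diff_distrib[symmetric]) (rule uq_ideal.left)
end

instantiation uq :: (cartan_datum) qalgebra
begin

lift_definition zero_uq :: "'a uq" is 0 .
lift_definition one_uq :: "'a uq" is 1 .

lift_definition plus_uq :: "'a uq \<Rightarrow> 'a uq \<Rightarrow> 'a uq" is "(+)"
  unfolding uq_eq_def by (subst add_diff_add) (rule uq_ideal.add)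

lift_definition uminus_uq :: "'a uq \<Rightarrow> 'a uq" is uminus
  unfolding uq_eq_def by (subst minus_diff_minus) (rule uq_ideal_minus)

lift_definition minus_uq :: "'a uq \<Rightarrow> 'a uq \<Rightarrow> 'a uq" is "(-)"
proof -
  fix x x' y y' :: "'a free_alg"
  assume "uq_eq x x'" "uq_eq y y'"
  then have "(x - x') - (y - y') \<in> uq_ideal"
    unfolding uq_eq_def by (rule uq_ideal_diff)
  moreover have "(x - x') - (y - y') = x - y - (x' - y')" by (simp add: algebra_simps)
  ultimately show "uq_eq (x - y) (x' - y')"
    unfolding uq_eq_def by (simp only:)
qed

lift_definition times_uq :: "'a uq \<Rightarrow> 'a uq \<Rightarrow> 'a uq" is "(*)"
proof -
  fix x x' y y' :: "'a free_alg"
  assume "uq_eq x x'" "uq_eq y y'"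
  then have "(x - x') * y + x' * (y - y') \<in> uq_ideal"
    unfolding uq_eq_def by (intro uq_ideal.add uq_ideal.left uq_ideal.right)
  moreover have "(x - x') * y + x' * (y - y') = x * y - x' * y'" by (simp add: algebra_simps)
  ultimately show "uq_eq (x * y) (x' * y')"
    unfolding uq_eq_def by (simp only:)
qed

definition scaleq_uq :: "qf \<Rightarrow> 'a uq \<Rightarrow> 'a uq" where
  "scaleq_uq = uq_scale"

lemma scaleq_uq_transfer [transfer_rule]:
  "rel_fun (=) (rel_fun cr_uq cr_uq) (\<lambda>a. (*) (fconst a))
    (scaleq :: qf \<Rightarrow> 'a uq \<Rightarrow> 'a uq)"
  unfolding scaleq_uq_def
  by (intro rel_funI, hypsubst, erule rel_funD[OF uq_scale.transfer])

instance
proof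
  fix a b :: qf and x y z :: "'a uq"
  show "x + y + z = x + (y + z)"
    by transfer (simp add: add.assoc uq_eq_refl)
  show "x + y = y + x"
    by transfer (simp add: add.commute uq_eq_refl)
  show "0 + x = x"
    by transfer (simp add: uq_eq_refl)
  show "- x + x = 0"
    by transfer (simp add: uq_eq_refl)
  show "x - y = x + - y"
    by transfer (simp add: uq_eq_refl)
  show "x * y * z = x * (y * z)"
    by transfer (simp add: mult.assoc uq_eq_refl)
  show "(x + y) * z = x * z + y * z"
    by transfer (simp add: distrib_right uq_eq_refl)
  show "x * (y + z) = x * y + x * z"
    by transfer (simp add: distrib_left uq_eq_refl)
  show "1 * x = x"
    by transfer (simp add: uq_eq_refl)
  show "x * 1 = x"
    by transfer (simp add: uq_eq_refl)
  show "a *\<^sub>q (x + y) = a *\<^sub>q x + a *\<^sub>q y"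
    by (transfer fixing: a b) (simp add: distrib_left uq_eq_refl)
  show "(a + b) *\<^sub>q x = a *\<^sub>q x + b *\<^sub>q x"
    by (transfer fixing: a b) (simp add: distrib_right single_add uq_eq_refl)
  show "a *\<^sub>q (b *\<^sub>q x) = (a * b) *\<^sub>q x"
    by (transfer fixing: a b) (simp add: mult.assoc[symmetric] mult_single plus_list_def uq_eq_refl)
  show "1 *\<^sub>q x = x"
    by (transfer fixing: a b) (simp add: zero_list_def[symmetric] uq_eq_refl)
  show "(a *\<^sub>q x) * y = a *\<^sub>q (x * y)"
    by (transfer fixing: a b) (simp add: mult.assoc uq_eq_refl)
  show "x * (a *\<^sub>q y) = a *\<^sub>q (x * y)"
  proof (transfer fixing: a b)
    fix x y :: "'a free_alg"
    show "uq_eq (x * (fconst a * y)) (fconst a * (x * y))"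
      by (simp only: fconst_central mult.assoc uq_eq_refl)
  qed
qed

end

lift_definition uE :: "'i::cartan_datum \<Rightarrow> 'i uq" is "\<lambda>i. fgen (GenE i)" .
lift_definition uF :: "'i::cartan_datum \<Rightarrow> 'i uq" is "\<lambda>i. fgen (GenF i)" .

text \<open>\<open>K_\<beta>\<close> for \<open>\<beta> = \<Sum>\<^sub>i n_i \<alpha>_i\<close> in \<open>\<onehalf>Q\<close> is \<open>K_h\<close> with \<open>h = \<Sum>\<^sub>i n_i \<epsilon>_i h_i\<close>.\<close>

lift_definition uK :: "('i::cartan_datum \<Rightarrow> rat) \<Rightarrow> 'i uq"
  is "\<lambda>\<beta>. fgen (GenK (\<lambda>i. \<lfloor>2 * \<beta> i\<rfloor> * int (eps i)))" .

definition Uq :: "'i::cartan_datum uq set" where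
  "Uq = subalg (range uE \<union> range uF \<union> range (\<lambda>i. uK (simple i)) \<union> range (\<lambda>i. uK (- simple i)))"


section \<open>The quantum involution\<close>

text \<open>
  An automorphism of \<open>U_q(g')\<close> is determined by its values on \<open>E_i\<close>, \<open>F_i\<close>, \<open>K_i\<close>; values
  outside \<open>U_q(g')\<close> are irrelevant.
\<close>

definition Uq_aut ::
  "('i::cartan_datum \<Rightarrow> 'i uq) \<Rightarrow> ('i \<Rightarrow> 'i uq) \<Rightarrow> ('i \<Rightarrow> 'i uq) \<Rightarrow> 'i uq \<Rightarrow> 'i uq" where
  "Uq_aut e f k = (SOME \<phi>. alg_aut_on Uq \<phi> \<and>
     (\<forall>i. \<phi> (uE i) = e i \<and> \<phi> (uF i) = f i \<and> \<phi> (uK (simple i)) = k i))"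

definition omega :: "'i::cartan_datum uq \<Rightarrow> 'i uq" where
  "omega = Uq_aut (\<lambda>i. - uF i) (\<lambda>i. - uE i) (\<lambda>i. uK (- simple i))"

definition tau_aut :: "('i \<Rightarrow> 'i) \<Rightarrow> 'i::cartan_datum uq \<Rightarrow> 'i uq" where
  "tau_aut \<tau> = Uq_aut (\<lambda>i. uE (\<tau> i)) (\<lambda>i. uF (\<tau> i)) (\<lambda>i. uK (simple (\<tau> i)))"

definition psi :: "'i::cartan_datum uq \<Rightarrow> 'i uq" where
  "psi = Uq_aut (\<lambda>i. uE i * uK (simple i)) (\<lambda>i. uK (- simple i) * uF i) (\<lambda>i. uK (simple i))"

definition divpow :: "qf \<Rightarrow> 'i::cartan_datum uq \<Rightarrow> nat \<Rightarrow> 'i uq" where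
  "divpow v z n = inverse (qfact v n) *\<^sub>q z ^ n"

definition lusztig :: "'i::cartan_datum \<Rightarrow> 'i uq \<Rightarrow> 'i uq" where
  "lusztig i = Uq_aut
     (\<lambda>j. if j = i then - (uF i * uK (simple i)) else
        (\<Sum>r = 0..nat (- cartan i j). ((- 1) ^ r * inverse (qi i) ^ r) *\<^sub>q
           (divpow (qi i) (uE i) (nat (- cartan i j) - r) * uE j * divpow (qi i) (uE i) r)))
     (\<lambda>j. if j = i then - (uK (- simple i) * uE i) else
        (\<Sum>r = 0..nat (- cartan i j). ((- 1) ^ r * qi i ^ r) *\<^sub>q
           (divpow (qi i) (uF i) r * uF j * divpow (qi i) (uF i) (nat (- cartan i j) - r))))
     (\<lambda>j. uK (refl i (simple j)))"

definition T_long :: "'i::cartan_datum set \<Rightarrow> 'i uq \<Rightarrow> 'i uq" where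
  "T_long X = foldr (\<lambda>i f. lusztig i \<circ> f) (longest_word X) id"

text \<open>\<open>has_weight u \<beta>\<close>: \<open>u\<close> lies in the component of degree \<open>\<beta>\<close> of the \<open>Q\<close>-graded algebra \<open>U_q(g')\<close>.\<close>

inductive has_weight :: "'i::cartan_datum uq \<Rightarrow> ('i \<Rightarrow> rat) \<Rightarrow> bool" where
  E: "has_weight (uE i) (simple i)"
| F: "has_weight (uF i) (- simple i)"
| K: "\<beta> \<in> Qlat \<Longrightarrow> has_weight (uK \<beta>) 0"
| zero: "\<beta> \<in> Qlat \<Longrightarrow> has_weight 0 \<beta>"
| add: "has_weight x \<beta> \<Longrightarrow> has_weight y \<beta> \<Longrightarrow> has_weight (x + y) \<beta>"
| scale: "has_weight x \<beta> \<Longrightarrow> has_weight (a *\<^sub>q x) \<beta>"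
| mult: "has_weight x \<beta> \<Longrightarrow> has_weight y \<gamma> \<Longrightarrow> has_weight (x * y) (\<beta> + \<gamma>)"

definition s_simple :: "'i::cartan_datum set \<Rightarrow> ('i \<Rightarrow> 'i) \<Rightarrow> 'i \<Rightarrow> complex" where
  "s_simple X \<tau> j =
     (if j \<in> X \<or> \<tau> j = j then 1
      else if \<tau> j > j then \<i> powi \<lfloor>ev (simple j) (\<lambda>i. 2 * rho_check X i)\<rfloor>
      else (- \<i>) powi \<lfloor>ev (simple j) (\<lambda>i. 2 * rho_check X i)\<rfloor>)"

definition s_hom :: "'i::cartan_datum set \<Rightarrow> ('i \<Rightarrow> 'i) \<Rightarrow> ('i \<Rightarrow> rat) \<Rightarrow> complex" where
  "s_hom X \<tau> \<beta> = (\<Prod>j\<in>UNIV. s_simple X \<tau> j powi \<lfloor>\<beta> j\<rfloor>)"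

definition Ad_s :: "'i::cartan_datum set \<Rightarrow> ('i \<Rightarrow> 'i) \<Rightarrow> 'i uq \<Rightarrow> 'i uq" where
  "Ad_s X \<tau> = (SOME \<phi>. alg_aut_on Uq \<phi> \<and>
     (\<forall>u \<beta>. has_weight u \<beta> \<longrightarrow> \<phi> u = const_qf (s_hom X \<tau> \<beta>) *\<^sub>q u))"

definition theta_q :: "'i::cartan_datum set \<Rightarrow> ('i \<Rightarrow> 'i) \<Rightarrow> 'i uq \<Rightarrow> 'i uq" where
  "theta_q X \<tau> = Ad_s X \<tau> \<circ> T_long X \<circ> psi \<circ> tau_aut \<tau> \<circ> omega"


section \<open>Coideal subalgebras and spherical functions\<close>

text \<open>
  Families indexed by \<open>I \<setminus> X\<close> are functions on \<open>I\<close> whose values on \<open>X\<close> are never used.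
\<close>

definition coideal_params :: "'i set \<Rightarrow> ('i \<Rightarrow> qf) \<Rightarrow> ('i \<Rightarrow> qf) \<Rightarrow> bool" where
  "coideal_params X c s \<longleftrightarrow> (\<forall>i. i \<notin> X \<longrightarrow> c i \<in> Cq \<and> c i \<noteq> 0 \<and> s i \<in> Cq)"

definition Bgen ::
  "'i::cartan_datum set \<Rightarrow> ('i \<Rightarrow> 'i) \<Rightarrow> ('i \<Rightarrow> qf) \<Rightarrow> ('i \<Rightarrow> qf) \<Rightarrow> 'i \<Rightarrow> 'i uq" where
  "Bgen X \<tau> c s i = uF i + c i *\<^sub>q (theta_q X \<tau> (uF i * uK (simple i)) * uK (- simple i))
     + s i *\<^sub>q uK (- simple i)"

definition Bcheck ::
  "'i::cartan_datum set \<Rightarrow> ('i \<Rightarrow> 'i) \<Rightarrow> ('i \<Rightarrow> qf) \<Rightarrow> ('i \<Rightarrow> qf) \<Rightarrow> 'i uq set" where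
  "Bcheck X \<tau> c s = subalg (Bgen X \<tau> c s ` (- X) \<union> uE ` X \<union> uF ` X
     \<union> uK ` {\<beta> \<in> Qcheck. \<forall>i. i \<notin> X \<longrightarrow> \<beta> i = 0}
     \<union> uK ` Qplus X \<tau>)"

definition simple_generators :: "'i::cartan_datum set \<Rightarrow> ('i \<Rightarrow> 'i) \<Rightarrow> bool" where
  "simple_generators X \<tau> \<longleftrightarrow>
     (\<forall>i. i \<notin> X \<longrightarrow> (\<exists>v. v \<in> Cq \<and> v \<noteq> 0 \<and>
        theta_q X \<tau> (uF i * uK (simple i)) = - (v *\<^sub>q uE (\<tau> i))))"

definition Acheck :: "'i::cartan_datum set \<Rightarrow> ('i \<Rightarrow> 'i) \<Rightarrow> 'i uq set" where
  "Acheck X \<tau> = subalg (uK ` Qminus X \<tau>)"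

definition spherical_functions ::
  "'i::cartan_datum uq set \<Rightarrow> 'i uq set \<Rightarrow> ('i uq \<Rightarrow> 'v \<Rightarrow> 'v::qspace) \<Rightarrow> ('i uq \<Rightarrow> 'w \<Rightarrow> 'w::qspace)
   \<Rightarrow> ('i uq \<Rightarrow> 'w \<Rightarrow> 'v) set" where
  "spherical_functions B B' t1 t2 = {\<Phi>. qlinear \<Phi> \<and> (\<forall>z. qlinear (\<Phi> z)) \<and>
     (\<forall>b\<in>B. \<forall>b'\<in>B'. \<forall>z. \<Phi> (b * z * b') = t1 b \<circ> \<Phi> z \<circ> t2 b')}"

definition act :: "'i::cartan_datum uq \<Rightarrow> ('i uq \<Rightarrow> 'h) \<Rightarrow> 'i uq \<Rightarrow> 'h" where
  "act y \<Phi> = (\<lambda>z. \<Phi> (z * y))"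

definition Res :: "'i::cartan_datum set \<Rightarrow> ('i \<Rightarrow> 'i) \<Rightarrow> ('i uq \<Rightarrow> 'h) \<Rightarrow> 'i uq \<Rightarrow> 'h" where
  "Res X \<tau> \<Phi> = restrict \<Phi> (Acheck X \<tau>)"


section \<open>Regular points\<close>

definition F_word :: "'i::cartan_datum list \<Rightarrow> 'i uq" where
  "F_word us = prod_list (map uF us)"

definition mu_root :: "'i::cartan_datum set \<Rightarrow> ('i \<Rightarrow> 'i) \<Rightarrow> 'i \<Rightarrow> 'i \<Rightarrow> rat" where
  "mu_root X \<tau> i = (\<lambda>j. (simple i j - Theta X \<tau> (simple i) j) / 2)"

text \<open>For the empty word the condition is void, which gives \<open>A_reg(1)\<close>.\<close>

definition Areg_word ::
  "'i::cartan_datum set \<Rightarrow> ('i \<Rightarrow> 'i) \<Rightarrow> ('i \<Rightarrow> qf) \<Rightarrow> ('i \<Rightarrow> qf) \<Rightarrow> 'i list \<Rightarrow> 'i uq set" where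
  "Areg_word X \<tau> c d us = uK ` {lam \<in> Qminus X \<tau>.
     \<forall>l<length us. \<forall>vs N. length vs = length us - l \<and> subseq vs us \<and>
       (\<forall>j<length us. N j \<in> {-1, 0, 1::int}) \<longrightarrow>
       (let k = length vs;
            \<mu> = (\<Sum>j<length us. (\<lambda>i. of_int (N j) * mu_root X \<tau> (us ! j) i))
        in prod_list (map c vs) / prod_list (map d vs) \<noteq>
          qpow ((\<Sum>i<k. form (lam + \<mu>) (simple (vs ! i) + simple (\<tau> (vs ! i))))
             - (\<Sum>i<k. \<Sum>j\<in>{..<k} - {i}. form (simple (vs ! i)) (simple (vs ! j)))))}"

text \<open>
  \<open>iw lam Y\<close> lists the triples \<open>(C_j, lam_j, V_j)\<close> of the chosen Iwasawa decomposition
  \<open>K_lam Y = \<Sum>\<^sub>j C_j K_{lam_j} F_{V_j}\<close>.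
\<close>

definition iwasawa_choice ::
  "'i::cartan_datum set \<Rightarrow> ('i \<Rightarrow> 'i) \<Rightarrow> ('i \<Rightarrow> qf) \<Rightarrow> ('i \<Rightarrow> qf)
   \<Rightarrow> (('i \<Rightarrow> rat) \<Rightarrow> 'i uq \<Rightarrow> ('i uq \<times> ('i \<Rightarrow> rat) \<times> 'i list) list) \<Rightarrow> bool" where
  "iwasawa_choice X \<tau> c s iw \<longleftrightarrow> (\<forall>lam\<in>Qminus X \<tau>. \<forall>Y\<in>Uq.
     (\<forall>(C, l, V)\<in>set (iw lam Y). C \<in> Bcheck X \<tau> c s \<and> l \<in> Qminus X \<tau> \<and> V \<in> lists (- X)) \<and>
     uK lam * Y = (\<Sum>(C, l, V)\<leftarrow>iw lam Y. C * uK l * F_word V))"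

definition Areg ::
  "'i::cartan_datum set \<Rightarrow> ('i \<Rightarrow> 'i) \<Rightarrow> ('i \<Rightarrow> qf) \<Rightarrow> ('i \<Rightarrow> qf)
   \<Rightarrow> (('i \<Rightarrow> rat) \<Rightarrow> 'i uq \<Rightarrow> ('i uq \<times> ('i \<Rightarrow> rat) \<times> 'i list) list) \<Rightarrow> 'i uq \<Rightarrow> 'i uq set" where
  "Areg X \<tau> c d iw Y = uK ` {lam \<in> Qminus X \<tau>.
     \<forall>(C, l, V)\<in>set (iw lam Y). uK l \<in> Areg_word X \<tau> c d V}"


section \<open>Radial parts\<close>

definition radial_part_choice ::
  "'i::cartan_datum set \<Rightarrow> ('i \<Rightarrow> 'i) \<Rightarrow> ('i \<Rightarrow> qf) \<Rightarrow> ('i \<Rightarrow> qf) \<Rightarrow> ('i \<Rightarrow> qf) \<Rightarrow> ('i \<Rightarrow> qf)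
   \<Rightarrow> (('i \<Rightarrow> rat) \<Rightarrow> 'i uq \<Rightarrow> ('i uq \<times> ('i \<Rightarrow> rat) \<times> 'i list) list)
   \<Rightarrow> ('i uq \<Rightarrow> 'i uq \<Rightarrow> ('i uq, 'i uq, 'i uq) tensor3) \<Rightarrow> bool" where
  "radial_part_choice X \<tau> c s d t iw Rad \<longleftrightarrow> (\<forall>Y\<in>Uq. \<forall>k\<in>Areg X \<tau> c d iw Y.
     \<exists>xs. (\<forall>(b, l, b')\<in>set xs. b \<in> Bcheck X \<tau> c s \<and> l \<in> Qminus X \<tau> \<and> b' \<in> Bcheck X \<tau> d t) \<and>
       Rad Y k = (\<Sum>(b, l, b')\<leftarrow>xs. pure3 b (uK l) b') \<and>
       (\<Sum>(b, l, b')\<leftarrow>xs. b * uK l * b') = k * Y)"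

definition radial_rep ::
  "'i::cartan_datum uq set \<Rightarrow> 'i uq set \<Rightarrow> 'i uq set
   \<Rightarrow> ('i uq \<Rightarrow> 'v \<Rightarrow> 'v::qspace) \<Rightarrow> ('i uq \<Rightarrow> 'w \<Rightarrow> 'w::qspace)
   \<Rightarrow> ('i uq, 'i uq, 'i uq) tensor3 \<Rightarrow> ('v \<Rightarrow> 'v, 'i uq, 'w \<Rightarrow> 'w) tensor3" where
  \<comment> \<open>\<open>t1 \<otimes> 1 \<otimes> t2\<close> on \<open>B \<otimes> A \<otimes> B'\<close>\<close>
  "radial_rep B A B' t1 t2 = induced3 B A B' (\<lambda>b a b'. pure3 (t1 b) a (t2 b'))"

definition pairing ::
  "'i::cartan_datum uq set \<Rightarrow> ('v \<Rightarrow> 'v, 'i uq, 'w \<Rightarrow> 'w) tensor3 \<Rightarrow> ('i uq \<Rightarrow> 'w \<Rightarrow> 'v)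
   \<Rightarrow> 'w::qspace \<Rightarrow> 'v::qspace" where
  \<comment> \<open>on \<open>End(V) \<otimes> A \<otimes> End(W)\<close>, for \<open>\<phi> : A \<rightarrow> Hom(W, V)\<close> linear\<close>
  "pairing A x \<phi> =
     induced3 {T. qlinear T} A {T. qlinear T} (\<lambda>T1 a T2. T1 \<circ> \<phi> a \<circ> T2) x"

end

theory Submission
  imports Defs
begin

text \<open>
  The identity expresses that a spherical function can be evaluated through any expression
  \<open>K_\<lambda> Y = \<Sum>\<^sub>i B_i K_{\<lambda>_i} B_i'\<close>: by linearity and sphericity,
  \<open>(Y.\<Phi>)(K_\<lambda>) = \<Phi>(K_\<lambda> Y) = \<Sum>\<^sub>i t1(B_i) \<Phi>(K_{\<lambda>_i}) t2(B_i')\<close>. The radial part records such an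
  expression as the tensor \<open>\<Sum>\<^sub>i B_i \<otimes> K_{\<lambda>_i} \<otimes> B_i'\<close>; its choice at each
  regular point \<open>K_\<lambda>\<close> is part of the data of \<open>\<Pi>(Y)\<close>.

  The substance of the proof is thus that the right-hand side can be computed from this expression.
  Both \<open>t1 \<otimes> 1 \<otimes> t2\<close> and the pairing are maps \<open>induced3\<close>, that is, they are selected by Hilbert choice
  among the linear maps with prescribed values on the pure tensors of given subspaces. Such a choice
  is meaningful only once a linear map with these values is known to exist (lemma
  \<open>induced3_trilinear\<close>). The prescribed values are trilinear on the subspaces only, so they are first
  extended to the whole spaces by composing with linear projections onto the subspaces; a
  trilinear map on the whole spaces then factors through the tensor product
  (lemma \<open>tensor3_universal\<close>). Trilinearity is immediate for \<open>t1 \<otimes> 1 \<otimes> t2\<close>, as \<open>t1\<close> and \<open>t2\<close> are linear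
  on the coideal subalgebras. For the pairing it rests on \<open>Res \<Phi>\<close> being linear on \<open>A\<close> with linear
  maps as values.
\<close>

section \<open>Linear maps\<close>

lemma qlinearI:
  assumes "\<And>x y. f (x + y) = f x + f y" and "\<And>a x. f (a *\<^sub>q x) = a *\<^sub>q f x"
  shows "qlinear f"
  unfolding Vector_Spaces.linear_iff
  using assms by (intro conjI allI qspace.vector_space_axioms)

lemma qlinear_add: "qlinear f \<Longrightarrow> f (x + y) = f x + f y"
  by (simp add: Vector_Spaces.linear_iff)

lemma qlinear_scale: "qlinear f \<Longrightarrow> f (a *\<^sub>q x) = a *\<^sub>q f x"
  by (simp add: Vector_Spaces.linear_iff)

lemma qlinear_0: "qlinear f \<Longrightarrow> f 0 = 0"
  by (metis add_cancel_right_right qlinear_add)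

lemma qlinear_sum_list: "qlinear f \<Longrightarrow> f (\<Sum>x\<leftarrow>xs. g x) = (\<Sum>x\<leftarrow>xs. f (g x))"
  by (induction xs) (simp_all add: qlinear_0 qlinear_add)

text \<open>Every subspace of a vector space has a complement, by extension of a basis.\<close>

lemma qlinear_projection:
  fixes S :: "'a::qspace set"
  assumes "qspace.subspace S"
  obtains p where "qlinear p" and "\<And>x. p x \<in> S" and "\<And>x. x \<in> S \<Longrightarrow> p x = x"
proof -
  interpret vector_space_pair "scaleq :: qf \<Rightarrow> 'a \<Rightarrow> 'a" "scaleq :: qf \<Rightarrow> 'a \<Rightarrow> 'a"
    by unfold_locales
  have "qlinear (\<lambda>x::'a. x)"
    by (rule qlinearI) auto
  from linear_exists_left_inverse_on[OF this assms] show thesis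
    using that by auto
qed

section \<open>The universal property of the threefold tensor product\<close>

lemma pure3_add1: "pure3 (u + u') v w = pure3 u v w + pure3 u' v w"
  by transfer (simp add: tensor_eq_def tensor_null.add1)

lemma pure3_add2: "pure3 u (v + v') w = pure3 u v w + pure3 u v' w"
  by transfer (simp add: tensor_eq_def tensor_null.add2)

lemma pure3_add3: "pure3 u v (w + w') = pure3 u v w + pure3 u v w'"
  by transfer (simp add: tensor_eq_def tensor_null.add3)

lemma pure3_scale1: "pure3 (a *\<^sub>q u) v w = a *\<^sub>q pure3 u v w"
  by (transfer fixing: a) (use tensor_null.scale1[where k = 1] in \<open>simp add: tensor_eq_def map_scale_single\<close>)

lemma pure3_scale2: "pure3 u (a *\<^sub>q v) w = a *\<^sub>q pure3 u v w"
  by (transfer fixing: a) (use tensor_null.scale2[where k = 1] in \<open>simp add: tensor_eq_def map_scale_single\<close>)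

lemma pure3_scale3: "pure3 u v (a *\<^sub>q w) = a *\<^sub>q pure3 u v w"
  by (transfer fixing: a) (use tensor_null.scale3[where k = 1] in \<open>simp add: tensor_eq_def map_scale_single\<close>)

definition trilinear_on ::
  "'a::qspace set \<Rightarrow> 'b::qspace set \<Rightarrow> 'c::qspace set \<Rightarrow> ('a \<Rightarrow> 'b \<Rightarrow> 'c \<Rightarrow> 'd::qspace) \<Rightarrow> bool" where
  "trilinear_on A B C \<beta> \<longleftrightarrow> (\<forall>u\<in>A. \<forall>v\<in>B. \<forall>w\<in>C.
     (\<forall>u'\<in>A. \<beta> (u + u') v w = \<beta> u v w + \<beta> u' v w) \<and>
     (\<forall>v'\<in>B. \<beta> u (v + v') w = \<beta> u v w + \<beta> u v' w) \<and>
     (\<forall>w'\<in>C. \<beta> u v (w + w') = \<beta> u v w + \<beta> u v w') \<and>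
     (\<forall>a. \<beta> (a *\<^sub>q u) v w = a *\<^sub>q \<beta> u v w \<and>
          \<beta> u (a *\<^sub>q v) w = a *\<^sub>q \<beta> u v w \<and>
          \<beta> u v (a *\<^sub>q w) = a *\<^sub>q \<beta> u v w))"

text \<open>The linear map on formal linear combinations that extends a map given on the basis.\<close>

definition lin_ext :: "('a \<Rightarrow> 'd::qspace) \<Rightarrow> ('a \<Rightarrow>\<^sub>0 qf) \<Rightarrow> 'd" where
  "lin_ext f x = (\<Sum>k\<in>Poly_Mapping.keys x. Poly_Mapping.lookup x k *\<^sub>q f k)"

lemma lin_ext_add: "lin_ext f (x + y) = lin_ext f x + lin_ext f y"
  unfolding lin_ext_def
  by (rule setsum_keys_plus_distrib) (simp_all add: scaleq_add_left)

lemma lin_ext_0: "lin_ext f 0 = 0"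
  by (simp add: lin_ext_def)

lemma lin_ext_minus: "lin_ext f (- x) = - lin_ext f x"
  using lin_ext_add[of f "- x" x] by (simp add: lin_ext_0 eq_neg_iff_add_eq_0)

lemma lin_ext_diff: "lin_ext f (x - y) = lin_ext f x - lin_ext f y"
  using lin_ext_add[of f x "- y"] by (simp add: lin_ext_minus)

lemma lin_ext_single: "lin_ext f (Poly_Mapping.single k a) = a *\<^sub>q f k"
  by (cases "a = 0") (simp_all add: lin_ext_def)

lemma lin_ext_scale: "lin_ext f (Poly_Mapping.map ((*) a) x) = a *\<^sub>q lin_ext f x"
proof -
  have lookup: "Poly_Mapping.lookup (Poly_Mapping.map ((*) a) x) k = a * Poly_Mapping.lookup x k" for k
    by (simp add: Poly_Mapping.map.rep_eq when_def)
  have "lin_ext f (Poly_Mapping.map ((*) a) x)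
      = (\<Sum>k\<in>Poly_Mapping.keys x. (a * Poly_Mapping.lookup x k) *\<^sub>q f k)"
    unfolding lin_ext_def lookup
    by (intro sum.mono_neutral_left) (auto simp: in_keys_iff lookup)
  then show ?thesis
    by (simp add: lin_ext_def qspace.scale_sum_right scaleq_scaleq)
qed

text \<open>
  The generators of the null space are the differences of the two sides of the trilinearity
  equations, so trilinearity makes the linear extension descend to the quotient.
\<close>

lemma lin_ext_tensor_null:
  assumes "trilinear_on UNIV UNIV UNIV \<beta>" and "x \<in> tensor_null"
  shows "lin_ext (\<lambda>(u, v, w). \<beta> u v w) x = 0"
  using assms(2)
  by induction
    (use assms(1) in \<open>auto simp: trilinear_on_def lin_ext_0 lin_ext_add lin_ext_minus lin_ext_diff
      lin_ext_single scaleq_add_right scaleq_scaleq mult.commute\<close>)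

lemma tensor3_universal:
  assumes "trilinear_on UNIV UNIV UNIV \<beta>"
  obtains f where "qlinear f" and "\<And>u v w. f (pure3 u v w) = \<beta> u v w"
proof -
  let ?L = "lin_ext (\<lambda>(u, v, w). \<beta> u v w)"
  define f where "f = ?L \<circ> rep_tensor3"
  have L: "?L x = ?L y" if "tensor_eq x y" for x y
    using lin_ext_tensor_null[OF assms] that by (force simp: tensor_eq_def lin_ext_diff)
  have f: "f (abs_tensor3 x) = ?L x" for x
    unfolding f_def o_apply
    by (rule L, rule rep_abs_rsp_left[OF Quotient3_tensor3]) (simp add: tensor_eq_def tensor_null.zero)
  show thesis
  proof (rule that)
    show "f (pure3 u v w) = \<beta> u v w" for u v w
      by (simp add: pure3.abs_eq f lin_ext_single scaleq_one)
    show "qlinear f"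
    proof (rule qlinearI)
      show "f (x + y) = f x + f y" for x y
        by (induction x; induction y) (simp add: plus_tensor3.abs_eq f lin_ext_add)
      show "f (a *\<^sub>q x) = a *\<^sub>q f x" for a x
        by (induction x) (simp add: scaleq_tensor3_def tensor3_scale.abs_eq f lin_ext_scale)
    qed
  qed
qed

text \<open>
  With projections \<open>p\<close>, \<open>q\<close>, \<open>r\<close> onto \<open>A\<close>, \<open>B\<close>, \<open>C\<close>, the map \<open>\<beta>(p u, q v, r w)\<close> is trilinear everywhere and
  agrees with \<open>\<beta>\<close> on \<open>A \<times> B \<times> C\<close>. Its linearization satisfies the defining condition of
  \<open>induced3\<close>, so the choice made there satisfies it too.
\<close>

lemma induced3_trilinear:
  assumes "qspace.subspace A" "qspace.subspace B" "qspace.subspace C"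
    and \<beta>: "trilinear_on A B C \<beta>"
  shows "qlinear (induced3 A B C \<beta>)"
    and "\<And>a b c. \<lbrakk>a \<in> A; b \<in> B; c \<in> C\<rbrakk> \<Longrightarrow> induced3 A B C \<beta> (pure3 a b c) = \<beta> a b c"
proof -
  obtain p where p: "qlinear p" "\<And>x. p x \<in> A" "\<And>x. x \<in> A \<Longrightarrow> p x = x"
    using qlinear_projection[OF assms(1)] by blast
  obtain q where q: "qlinear q" "\<And>x. q x \<in> B" "\<And>x. x \<in> B \<Longrightarrow> q x = x"
    using qlinear_projection[OF assms(2)] by blast
  obtain r where r: "qlinear r" "\<And>x. r x \<in> C" "\<And>x. x \<in> C \<Longrightarrow> r x = x"
    using qlinear_projection[OF assms(3)] by blast
  have "trilinear_on UNIV UNIV UNIV (\<lambda>u v w. \<beta> (p u) (q v) (r w))"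
    using \<beta> p(2) q(2) r(2) unfolding trilinear_on_def
    by (simp add: qlinear_add[OF p(1)] qlinear_add[OF q(1)] qlinear_add[OF r(1)]
        qlinear_scale[OF p(1)] qlinear_scale[OF q(1)] qlinear_scale[OF r(1)])
  then obtain f where "qlinear f" "\<And>u v w. f (pure3 u v w) = \<beta> (p u) (q v) (r w)"
    using tensor3_universal by blast
  then have "\<exists>f. qlinear f \<and> (\<forall>a\<in>A. \<forall>b\<in>B. \<forall>c\<in>C. f (pure3 a b c) = \<beta> a b c)"
    using p(3) q(3) r(3) by auto
  from someI_ex[OF this, folded induced3_def]
  show "qlinear (induced3 A B C \<beta>)"
    and "\<And>a b c. \<lbrakk>a \<in> A; b \<in> B; c \<in> C\<rbrakk> \<Longrightarrow> induced3 A B C \<beta> (pure3 a b c) = \<beta> a b c"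
    by blast+
qed

section \<open>Evaluation of the radial representation and of the pairing\<close>

lemma subspace_subalg: "qspace.subspace (subalg S)"
proof -
  have "0 \<in> subalg S"
    using subalg.scale[OF subalg.one, of 0] by (simp add: qspace.scale_zero_left)
  then show ?thesis
    by (simp add: qspace.subspace_def subalg.add subalg.scale)
qed

lemma subspace_qlinear: "qspace.subspace {T :: 'a::qspace \<Rightarrow> 'b::qspace. qlinear T}"
  unfolding qspace.subspace_def
  by (auto intro!: qlinearI simp: scaleq_fun_def qlinear_add qlinear_scale scaleq_add_right
      scaleq_scaleq mult.commute add_ac)

lemma radial_rep_sum:
  assumes "representation (subalg S) t1" and "representation (subalg S') t2"
    and xs: "\<And>b k b'. (b, k, b') \<in> set xs \<Longrightarrow> b \<in> subalg S \<and> k \<in> subalg K \<and> b' \<in> subalg S'"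
  shows "radial_rep (subalg S) (subalg K) (subalg S') t1 t2 (\<Sum>(b, k, b')\<leftarrow>xs. pure3 b k b')
    = (\<Sum>(b, k, b')\<leftarrow>xs. pure3 (t1 b) k (t2 b'))"
proof -
  have tri: "trilinear_on (subalg S) (subalg K) (subalg S') (\<lambda>b k b'. pure3 (t1 b) k (t2 b'))"
    using assms(1,2) by (simp add: trilinear_on_def representation_def pure3_add1 pure3_add2
        pure3_add3 pure3_scale1 pure3_scale2 pure3_scale3)
  note ind = induced3_trilinear[OF subspace_subalg subspace_subalg subspace_subalg tri]
  show ?thesis
    unfolding radial_rep_def qlinear_sum_list[OF ind(1)]
    by (intro arg_cong[where f = sum_list] map_cong) (auto dest!: xs simp: ind(2))
qed

text \<open>
  Linearity of \<open>T \<circ> \<phi> a \<circ> T'\<close> in \<open>T'\<close> uses that \<open>T\<close> and \<open>\<phi> a\<close> are linear maps. This is why the pairing is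
  formed on linear endomorphisms and why the values of \<open>\<phi>\<close> have to be linear, besides \<open>\<phi>\<close> itself.
  Linearity of \<open>\<phi>\<close> is required on \<open>A\<close> only, since restricted maps are \<open>undefined\<close> elsewhere.
\<close>

lemma pairing_sum:
  assumes "qspace.subspace A"
    and \<phi>: "\<And>a. a \<in> A \<Longrightarrow> qlinear (\<phi> a)"
      "\<And>a b. \<lbrakk>a \<in> A; b \<in> A\<rbrakk> \<Longrightarrow> \<phi> (a + b) = \<phi> a + \<phi> b"
      "\<And>x a. a \<in> A \<Longrightarrow> \<phi> (x *\<^sub>q a) = x *\<^sub>q \<phi> a"
    and xs: "\<And>x. x \<in> set xs \<Longrightarrow> qlinear (T x) \<and> k x \<in> A \<and> qlinear (T' x)"
  shows "pairing A (\<Sum>x\<leftarrow>xs. pure3 (T x) (k x) (T' x)) \<phi> = (\<Sum>x\<leftarrow>xs. T x \<circ> \<phi> (k x) \<circ> T' x)"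
proof -
  have tri: "trilinear_on {T. qlinear T} A {T. qlinear T} (\<lambda>T a T'. T \<circ> \<phi> a \<circ> T')"
    unfolding trilinear_on_def
    by (auto simp: fun_eq_iff scaleq_fun_def \<phi> qlinear_add qlinear_scale
         qlinear_add[OF \<phi>(1)] qlinear_scale[OF \<phi>(1)])
  note ind = induced3_trilinear[OF subspace_qlinear assms(1) subspace_qlinear tri]
  show ?thesis
    unfolding pairing_def qlinear_sum_list[OF ind(1)]
    by (intro arg_cong[where f = sum_list] map_cong) (auto dest!: xs simp: ind(2))
qed

section \<open>Radial parts of spherical functions\<close>

lemma uK_in_Acheck: "l \<in> Qminus X \<tau> \<Longrightarrow> uK l \<in> Acheck X \<tau>"
  unfolding Acheck_def by (intro subalg.gen imageI)

theorem theorem5p4: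
  fixes X :: "'i::cartan_datum set" and \<tau> :: "'i \<Rightarrow> 'i"
    and c s d t :: "'i \<Rightarrow> qf"
    and t1 :: "'i uq \<Rightarrow> 'v \<Rightarrow> 'v::qspace" and t2 :: "'i uq \<Rightarrow> 'w \<Rightarrow> 'w::qspace"
    and iw :: "('i \<Rightarrow> rat) \<Rightarrow> 'i uq \<Rightarrow> ('i uq \<times> ('i \<Rightarrow> rat) \<times> 'i list) list"
    and Rad :: "'i uq \<Rightarrow> 'i uq \<Rightarrow> ('i uq, 'i uq, 'i uq) tensor3"
    and Y :: "'i uq" and \<Phi> :: "'i uq \<Rightarrow> 'w \<Rightarrow> 'v"
  assumes "admissible X \<tau>"
    and "coideal_params X c s" and "coideal_params X d t"
    and "simple_generators X \<tau>"
    and "qfinite_dim (UNIV :: 'v set)" and "representation (Bcheck X \<tau> c s) t1"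
    and "qfinite_dim (UNIV :: 'w set)" and "representation (Bcheck X \<tau> d t) t2"
    and "iwasawa_choice X \<tau> c s iw"
    and "radial_part_choice X \<tau> c s d t iw Rad"
    and "Y \<in> Uq"
    and "\<Phi> \<in> spherical_functions (Bcheck X \<tau> c s) (Bcheck X \<tau> d t) t1 t2"
  shows "\<forall>lam\<in>Qminus X \<tau>. uK lam \<in> Areg X \<tau> c d iw Y \<longrightarrow>
    Res X \<tau> (act Y \<Phi>) (uK lam) =
      pairing (Acheck X \<tau>)
        (radial_rep (Bcheck X \<tau> c s) (Acheck X \<tau>) (Bcheck X \<tau> d t) t1 t2 (Rad Y (uK lam)))
        (Res X \<tau> \<Phi>)"
proof (intro ballI impI)
  fix lam assume lam: "lam \<in> Qminus X \<tau>" and reg: "uK lam \<in> Areg X \<tau> c d iw Y"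
  let ?B = "Bcheck X \<tau> c s" and ?B' = "Bcheck X \<tau> d t" and ?A = "Acheck X \<tau>"
  have \<Phi>: "qlinear \<Phi>" "\<And>z. qlinear (\<Phi> z)"
      "\<And>b b' z. \<lbrakk>b \<in> ?B; b' \<in> ?B'\<rbrakk> \<Longrightarrow> \<Phi> (b * z * b') = t1 b \<circ> \<Phi> z \<circ> t2 b'"
    using assms(12) by (auto simp: spherical_functions_def)
  from assms(10,11) reg have "\<exists>xs. (\<forall>(b, l, b')\<in>set xs. b \<in> ?B \<and> l \<in> Qminus X \<tau> \<and> b' \<in> ?B') \<and>
      Rad Y (uK lam) = (\<Sum>(b, l, b')\<leftarrow>xs. pure3 b (uK l) b') \<and>
      (\<Sum>(b, l, b')\<leftarrow>xs. b * uK l * b') = uK lam * Y"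
    unfolding radial_part_choice_def by blast
  then obtain xs where
    xs: "\<And>b l b'. (b, l, b') \<in> set xs \<Longrightarrow> b \<in> ?B \<and> l \<in> Qminus X \<tau> \<and> b' \<in> ?B'"
    and Rad: "Rad Y (uK lam) = (\<Sum>(b, l, b')\<leftarrow>xs. pure3 b (uK l) b')"
    and KY: "uK lam * Y = (\<Sum>(b, l, b')\<leftarrow>xs. b * uK l * b')"
    by (metis (mono_tags, lifting) case_prodD)
  have A: "qspace.subspace ?A" unfolding Acheck_def by (rule subspace_subalg)
  \<comment> \<open>Now both linear maps are applied termwise to the tensor. Sphericity reassembles the terms to
    \<open>\<Phi>(K_\<lambda> Y)\<close>.\<close>
  have "radial_rep ?B ?A ?B' t1 t2 (Rad Y (uK lam))
      = (\<Sum>(b, l, b')\<leftarrow>xs. pure3 (t1 b) (uK l) (t2 b'))"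
    using radial_rep_sum[OF assms(6,8)[unfolded Bcheck_def],
        of "map (\<lambda>(b, l, b'). (b, uK l, b')) xs", where K = "uK ` Qminus X \<tau>"]
      xs uK_in_Acheck
    unfolding Rad Bcheck_def Acheck_def by (force simp: comp_def case_prod_unfold)
  then have "pairing ?A (radial_rep ?B ?A ?B' t1 t2 (Rad Y (uK lam))) (Res X \<tau> \<Phi>)
      = pairing ?A (\<Sum>x\<leftarrow>xs. pure3 (t1 (fst x)) (uK (fst (snd x))) (t2 (snd (snd x)))) (Res X \<tau> \<Phi>)"
    by (simp add: case_prod_unfold)
  also have "\<dots> = (\<Sum>x\<leftarrow>xs. t1 (fst x) \<circ> Res X \<tau> \<Phi> (uK (fst (snd x))) \<circ> t2 (snd (snd x)))"
    using A
  proof (rule pairing_sum)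
    show "qlinear (t1 (fst x)) \<and> uK (fst (snd x)) \<in> ?A \<and> qlinear (t2 (snd (snd x)))"
      if "x \<in> set xs" for x
      using xs[of "fst x" "fst (snd x)" "snd (snd x)"] that assms(6,8) uK_in_Acheck
      by (auto simp: representation_def)
  qed (use A \<Phi>(2) in \<open>auto simp: Res_def qspace.subspace_add qspace.subspace_scale
         qlinear_add[OF \<Phi>(1)] qlinear_scale[OF \<Phi>(1)]\<close>)
  also have "\<dots> = (\<Sum>(b, l, b')\<leftarrow>xs. \<Phi> (b * uK l * b'))"
    by (intro arg_cong[where f = sum_list] map_cong)
      (auto dest!: xs simp: \<Phi>(3) Res_def uK_in_Acheck)
  also have "\<dots> = \<Phi> (uK lam * Y)"
    unfolding KY qlinear_sum_list[OF \<Phi>(1)] by (simp add: case_prod_unfold)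
  also have "\<dots> = Res X \<tau> (act Y \<Phi>) (uK lam)"
    using uK_in_Acheck[OF lam] by (simp add: Res_def act_def)
  finally show "Res X \<tau> (act Y \<Phi>) (uK lam)
      = pairing ?A (radial_rep ?B ?A ?B' t1 t2 (Rad Y (uK lam))) (Res X \<tau> \<Phi>)" ..
qed

end
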